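(* Consider a $k$-CS-PIP instance in which $s_{ij}\le c_j$ for all $i,j$, rescaled so that for every constraint $j$, $\max_{i: s_{ij}>0}s_{ij}=1$; then $B:=\min_j c_j\ge1$ equals the slack. Set $\alpha:=4e(\lfloor B\rfloor k)^{1/\lfloor B\rfloor}$ and let $x$ be an optimal solution of the natural LP relaxation. Put each item $i$ in $\mathcal{S}$ independently with probability $x_i/\alpha$. For each item $i$ and constraint $j$ with $s_{ij}>0$, let $t_{ij}$ be the smallest number of the form $2^{-a}$, $a\in\mathbb{Z}_{\ge0}$, with $t_{ij}\ge s_{ij}$; let $E_{ij}$ be the event that the items $\{i'\in\mathcal{S}\mid t_{i'j}\ge t_{ij}\}$ have total $t$-size $\sum t_{i'j}$ exceeding $c_j$. Let $\mathcal{S}'$ be the set of $i\in\mathcal{S}$ for which no $E_{ij}$ occurs (over $j$ with $s_{ij}>0$). Then for each item $i$ (with $x_i>0$), $\Pr[i\in\mathcal{S}'\mid i\in\mathcal{S}]\ge\left(1-\frac{1}{k\lfloor B\rfloor}\right)^k$.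
   Context: $k$-CS-PIP: maximize $w^Tx$ subject to $Sx\le c$, $x\in\{0,1\}^n$, with $w\in\mathbb{R}^n_+$, $c\in\mathbb{R}^m_+$, $S=(s_{ij})\in\mathbb{R}_+^{m\times n}$ having at most $k$ nonzero entries per column. The slack is $\min\{c_j/s_{ij}: s_{ij}>0\}$. The natural LP relaxation replaces $x\in\{0,1\}^n$ by $x\in[0,1]^n$. *)

theory Defs
  imports "HOL-Probability.Probability"
begin

text \<open>
  The matrix \<open>S\<close> has one row per constraint and one column per item, so the size \<open>s\<^sub>i\<^sub>j\<close> of item
  \<open>i\<close> in constraint \<open>j\<close> is \<open>S $ j $ i\<close>. Inequalities between vectors are componentwise.
\<close>

definition k_cs_pip :: "nat \<Rightarrow> real^'n \<Rightarrow> real^'n^'m \<Rightarrow> real^'m \<Rightarrow> bool" where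
  "k_cs_pip k w S c \<longleftrightarrow>
     0 \<le> w \<and> 0 \<le> c \<and> (\<forall>j i. 0 \<le> S $ j $ i) \<and> (\<forall>i. card {j. S $ j $ i \<noteq> 0} \<le> k)"

definition slack :: "real^'n^'m \<Rightarrow> real^'m \<Rightarrow> real" where
  "slack S c = Min {c $ j / S $ j $ i | i j. S $ j $ i > 0}"

text \<open>
  Nonemptiness is required explicitly because the value of \<open>Max {}\<close> is unspecified.
\<close>

definition rescaled :: "real^'n^'m \<Rightarrow> bool" where
  "rescaled S \<longleftrightarrow>
     (\<forall>j. {S $ j $ i | i. S $ j $ i > 0} \<noteq> {} \<and> Max {S $ j $ i | i. S $ j $ i > 0} = 1)"

definition lp_feasible :: "real^'n^'m \<Rightarrow> real^'m \<Rightarrow> real^'n \<Rightarrow> bool" where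
  "lp_feasible S c x \<longleftrightarrow> S *v x \<le> c \<and> (\<forall>i. 0 \<le> x $ i \<and> x $ i \<le> 1)"

definition lp_optimal :: "real^'n \<Rightarrow> real^'n^'m \<Rightarrow> real^'m \<Rightarrow> real^'n \<Rightarrow> bool" where
  "lp_optimal w S c x \<longleftrightarrow> is_arg_max (\<lambda>y. w \<bullet> y) (lp_feasible S c) x"

text \<open>
  The number \<open>t\<^sub>i\<^sub>j\<close> is \<open>pow2_ceil (S $ j $ i)\<close>. It is meaningful only for arguments in \<open>(0, 1]\<close>;
  outside that range the minimum does not exist.
\<close>

definition pow2_ceil :: "real \<Rightarrow> real" where
  "pow2_ceil s = (LEAST t. (\<exists>a::nat. t = 1 / 2 ^ a) \<and> s \<le> t)"

text \<open>
  \<open>overflow S c A i j\<close> is the event \<open>E\<^sub>i\<^sub>j\<close> when the sampled set is \<open>A\<close>. Items that do not occur in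
  constraint \<open>j\<close> have no \<open>t\<close>-size there and are left out of the sum.
\<close>

definition overflow :: "real^'n^'m \<Rightarrow> real^'m \<Rightarrow> 'n set \<Rightarrow> 'n \<Rightarrow> 'm \<Rightarrow> bool" where
  "overflow S c A i j \<longleftrightarrow>
     (\<Sum>i' \<in> {i' \<in> A. S $ j $ i' > 0 \<and> pow2_ceil (S $ j $ i') \<ge> pow2_ceil (S $ j $ i)}.
        pow2_ceil (S $ j $ i')) > c $ j"

definition altered :: "real^'n^'m \<Rightarrow> real^'m \<Rightarrow> 'n set \<Rightarrow> 'n set" where
  "altered S c A = {i \<in> A. \<forall>j. S $ j $ i > 0 \<longrightarrow> \<not> overflow S c A i j}"

end

theory Submission
  imports Defs
begin

text \<open>
  Condition on \<open>i \<in> \<S>\<close>. Every event \<open>\<not> E\<^sub>i\<^sub>j\<close> is decreasing in the remaining sampled items, so by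
  the Harris inequality the probability that none of the at most \<open>k\<close> events \<open>E\<^sub>i\<^sub>j\<close> occurs is at
  least the product of the individual probabilities. All \<open>t\<close>-sizes counted in \<open>E\<^sub>i\<^sub>j\<close> are multiples of
  \<open>t\<^sub>i\<^sub>j\<close>, which is the reciprocal of an integer; hence on \<open>E\<^sub>i\<^sub>j\<close> the items other than \<open>i\<close> already
  have total size at least \<open>T = \<lfloor>c\<^sub>j\<rfloor>\<close>. The expected total size is at most \<open>2 c\<^sub>j / \<alpha>\<close>, because rounding
  at most doubles the sizes. The Chernoff bound with base \<open>e q\<close>, where \<open>q = (\<lfloor>B\<rfloor> k)\<^bsup>1/\<lfloor>B\<rfloor>\<^esup>\<close>, then gives
  \<open>Pr[E\<^sub>i\<^sub>j] \<le> q\<^bsup>-T\<^esup> \<le> 1 / (k \<lfloor>B\<rfloor>)\<close>.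
\<close>

section \<open>Expectations over independent Bernoulli subsets\<close>

text \<open>The mean of \<open>f\<close> over a random subset of \<open>I\<close> containing each
  \<open>i\<close> independently with probability \<open>p i\<close>. The explicit finite sum
  permits induction on \<open>I\<close> without measure theory;
  \<open>cond_prob_eq_bernoulli_expectation\<close> links it to the probability space.\<close>

definition bernoulli_expectation :: "('n \<Rightarrow> real) \<Rightarrow> 'n set \<Rightarrow> ('n set \<Rightarrow> real) \<Rightarrow> real" where
  "bernoulli_expectation p I f =
     (\<Sum>A \<in> Pow I. (\<Prod>i\<in>A. p i) * (\<Prod>i\<in>I - A. 1 - p i) * f A)"

lemma bernoulli_expectation_empty [simp]: "bernoulli_expectation p {} f = f {}"
  by (simp add: bernoulli_expectation_def)

text \<open>Conditioning on whether \<open>i\<close> is sampled; this recursion drives the later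
  inductions on \<open>I\<close>.\<close>

lemma bernoulli_expectation_insert:
  assumes "finite I" "i \<notin> I"
  shows "bernoulli_expectation p (insert i I) f =
    p i * bernoulli_expectation p I (\<lambda>A. f (insert i A)) + (1 - p i) * bernoulli_expectation p I f"
proof -
  let ?h = "\<lambda>A. (\<Prod>i\<in>A. p i) * (\<Prod>i\<in>insert i I - A. 1 - p i) * f A"
  have inj: "inj_on (insert i) (Pow I)"
    using assms by (auto simp: inj_on_def)
  have disj: "Pow I \<inter> insert i ` Pow I = {}"
    using assms by auto
  have without_i: "?h A = (1 - p i) * ((\<Prod>i\<in>A. p i) * (\<Prod>i\<in>I - A. 1 - p i) * f A)"
    if "A \<in> Pow I" for A
  proof -
    have "insert i I - A = insert i (I - A)" using that assms by auto
    thus ?thesis using assms by simp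
  qed
  have with_i: "?h (insert i A) =
      p i * ((\<Prod>i\<in>A. p i) * (\<Prod>i\<in>I - A. 1 - p i) * f (insert i A))"
    if "A \<in> Pow I" for A
  proof -
    have "insert i I - insert i A = I - A" "finite A" "i \<notin> A"
      using that assms by (auto intro: finite_subset)
    thus ?thesis by simp
  qed
  have "bernoulli_expectation p (insert i I) f = sum ?h (Pow I) + sum ?h (insert i ` Pow I)"
    unfolding bernoulli_expectation_def Pow_insert
    using assms disj by (intro sum.union_disjoint) auto
  also have "sum ?h (insert i ` Pow I) = (\<Sum>A\<in>Pow I. ?h (insert i A))"
    by (simp add: sum.reindex[OF inj])
  also have "\<dots> = p i * bernoulli_expectation p I (\<lambda>A. f (insert i A))"
    unfolding bernoulli_expectation_def sum_distrib_left by (intro sum.cong refl with_i)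
  also have "sum ?h (Pow I) = (1 - p i) * bernoulli_expectation p I f"
    unfolding bernoulli_expectation_def sum_distrib_left by (intro sum.cong refl without_i)
  finally show ?thesis by simp
qed

lemma bernoulli_expectation_cong:
  assumes "\<And>A. A \<subseteq> I \<Longrightarrow> f A = g A"
  shows "bernoulli_expectation p I f = bernoulli_expectation p I g"
  unfolding bernoulli_expectation_def using assms by (intro sum.cong) auto

lemma bernoulli_expectation_mono:
  assumes "\<And>i. i \<in> I \<Longrightarrow> 0 \<le> p i \<and> p i \<le> 1" and "\<And>A. A \<subseteq> I \<Longrightarrow> f A \<le> g A"
  shows "bernoulli_expectation p I f \<le> bernoulli_expectation p I g"
  unfolding bernoulli_expectation_def
  using assms by (intro sum_mono mult_left_mono mult_nonneg_nonneg prod_nonneg) auto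

lemma bernoulli_expectation_cmult:
  "bernoulli_expectation p I (\<lambda>A. a * f A) = a * bernoulli_expectation p I f"
  unfolding bernoulli_expectation_def sum_distrib_left by (simp add: mult_ac)

lemma bernoulli_expectation_diff:
  "bernoulli_expectation p I (\<lambda>A. f A - g A) =
     bernoulli_expectation p I f - bernoulli_expectation p I g"
  unfolding bernoulli_expectation_def by (simp add: algebra_simps sum_subtractf)

text \<open>By independence, each \<open>i\<close> contributes the mean of a factor that is
  \<open>u i\<close> with probability \<open>p i\<close> and 1 otherwise. With
  \<open>u i = 1\<close> this says that the weights sum to 1; with \<open>u i = y powr t i\<close>
  it is the moment generating function behind the Chernoff bound.\<close>

lemma bernoulli_expectation_prod:
  assumes "finite I"
  shows "bernoulli_expectation p I (\<lambda>A. \<Prod>i\<in>A. u i) = (\<Prod>i\<in>I. 1 + p i * (u i - 1))"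
  using assms
proof (induction I)
  case (insert i I)
  have "bernoulli_expectation p I (\<lambda>A. \<Prod>j\<in>insert i A. u j) =
      bernoulli_expectation p I (\<lambda>A. u i * (\<Prod>j\<in>A. u j))"
    using insert by (intro bernoulli_expectation_cong prod.insert) (auto intro: finite_subset)
  thus ?case using insert
    by (simp add: bernoulli_expectation_insert bernoulli_expectation_cmult algebra_simps)
qed simp

lemma bernoulli_expectation_const:
  "finite I \<Longrightarrow> bernoulli_expectation p I (\<lambda>A. a) = a"
  using bernoulli_expectation_prod[of I p "\<lambda>_. 1"] bernoulli_expectation_cmult[of p I a "\<lambda>_. 1"]
  by simp

lemma bernoulli_expectation_nonneg:
  assumes "\<And>i. i \<in> I \<Longrightarrow> 0 \<le> p i \<and> p i \<le> 1" and "\<And>A. A \<subseteq> I \<Longrightarrow> 0 \<le> f A"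
  shows "0 \<le> bernoulli_expectation p I f"
  unfolding bernoulli_expectation_def
  using assms by (intro sum_nonneg mult_nonneg_nonneg prod_nonneg) auto

section \<open>Positive correlation of decreasing functions\<close>

text \<open>Condition on the new element \<open>i\<close>. Within each of the two cases the
  induction hypothesis applies; across them both conditional means drop when \<open>i\<close> is
  sampled, so they are positively correlated (Chebyshev's inequality on two points).\<close>

lemma harris_inequality:
  assumes "finite I" and "\<And>i. i \<in> I \<Longrightarrow> 0 \<le> p i \<and> p i \<le> 1"
    and "antimono_on (Pow I) f" "antimono_on (Pow I) g"
  shows "bernoulli_expectation p I f * bernoulli_expectation p I g
    \<le> bernoulli_expectation p I (\<lambda>A. f A * g A)"
  using assms
proof (induction I arbitrary: f g)
  case (insert i I)
  let ?E = "bernoulli_expectation p I"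
  let ?f = "\<lambda>A. f (insert i A)" and ?g = "\<lambda>A. g (insert i A)"
  have p: "0 \<le> p i" "p i \<le> 1" "\<And>i. i \<in> I \<Longrightarrow> 0 \<le> p i \<and> p i \<le> 1"
    using insert.prems(1) by auto
  have mono: "antimono_on (Pow I) h" "antimono_on (Pow I) (\<lambda>A. h (insert i A))"
    "?E (\<lambda>A. h (insert i A)) \<le> ?E h"
    if h: "antimono_on (Pow (insert i I)) h" for h :: "'a set \<Rightarrow> real"
  proof -
    have le: "h B \<le> h A" if "A \<subseteq> B" "B \<subseteq> insert i I" for A B
      using h that unfolding monotone_on_def by auto
    show "antimono_on (Pow I) h" "antimono_on (Pow I) (\<lambda>A. h (insert i A))"
      by (auto simp: monotone_on_def intro!: le)
    show "?E (\<lambda>A. h (insert i A)) \<le> ?E h"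
      by (rule bernoulli_expectation_mono) (auto simp: p intro!: le)
  qed
  note f = mono[OF insert.prems(2)] and g = mono[OF insert.prems(3)]
  \<comment> \<open>This product is exactly the gap between the mixture of the products and the
    product of the mixtures.\<close>
  have "0 \<le> p i * (1 - p i) * ((?E f - ?E ?f) * (?E g - ?E ?g))"
    using p f(3) g(3) by (intro mult_nonneg_nonneg) auto
  hence "(p i * ?E ?f + (1 - p i) * ?E f) * (p i * ?E ?g + (1 - p i) * ?E g)
      \<le> p i * (?E ?f * ?E ?g) + (1 - p i) * (?E f * ?E g)"
    by (simp add: algebra_simps)
  also have "\<dots> \<le> p i * ?E (\<lambda>A. ?f A * ?g A) + (1 - p i) * ?E (\<lambda>A. f A * g A)"
    using p f g by (intro add_mono mult_left_mono insert.IH) auto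
  finally show ?case
    using insert.hyps by (simp add: bernoulli_expectation_insert)
qed simp

text \<open>Nonnegativity keeps partial products decreasing, so the inequality for two functions can
  be applied once per factor.\<close>

lemma harris_inequality_prod:
  assumes "finite I" and "\<And>i. i \<in> I \<Longrightarrow> 0 \<le> p i \<and> p i \<le> 1"
    and "finite J" and "\<And>j. j \<in> J \<Longrightarrow> antimono_on (Pow I) (f j)"
    and "\<And>j A. j \<in> J \<Longrightarrow> A \<subseteq> I \<Longrightarrow> 0 \<le> f j A"
  shows "(\<Prod>j\<in>J. bernoulli_expectation p I (f j)) \<le> bernoulli_expectation p I (\<lambda>A. \<Prod>j\<in>J. f j A)"
  using assms(3-5)
proof (induction J)
  case empty
  thus ?case using assms by (simp add: bernoulli_expectation_const)
next
  case (insert j J)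
  have anti: "antimono_on (Pow I) (\<lambda>A. \<Prod>j\<in>J. f j A)"
    using insert.prems by (auto simp: monotone_on_def intro!: prod_mono)
  have "(\<Prod>j\<in>insert j J. bernoulli_expectation p I (f j))
      \<le> bernoulli_expectation p I (f j) * bernoulli_expectation p I (\<lambda>A. \<Prod>j\<in>J. f j A)"
    using insert assms by (auto intro!: mult_left_mono bernoulli_expectation_nonneg)
  also have "\<dots> \<le> bernoulli_expectation p I (\<lambda>A. f j A * (\<Prod>j\<in>J. f j A))"
    using insert assms anti by (intro harris_inequality) auto
  finally show ?case using insert.hyps by simp
qed

section \<open>A Chernoff bound for sizes in [0, 1]\<close>

text \<open>Convexity of \<open>exp\<close> on the segment between 0 and
  \<open>ln y\<close>.\<close>

lemma powr_le_chord:
  fixes y t :: real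
  assumes "0 < y" "0 \<le> t" "t \<le> 1"
  shows "y powr t \<le> 1 + t * (y - 1)"
proof -
  have "exp ((1 - t) *\<^sub>R 0 + t *\<^sub>R ln y) \<le> (1 - t) * exp 0 + t * exp (ln y)"
    using assms by (intro convex_onD[OF exp_convex]) auto
  thus ?thesis using assms by (simp add: powr_def algebra_simps)
qed

text \<open>Markov's inequality for \<open>y\<close> raised to the total size, then independence and
  \<open>1 + u \<le> exp u\<close>. The exponent carries the factor \<open>y\<close> in place of the
  sharper \<open>y - 1\<close>.\<close>

lemma chernoff_bound:
  fixes t :: "'n \<Rightarrow> real"
  assumes "finite I" and p: "\<And>i. i \<in> I \<Longrightarrow> 0 \<le> p i \<and> p i \<le> 1"
    and t: "\<And>i. i \<in> I \<Longrightarrow> 0 \<le> t i \<and> t i \<le> 1" and "y \<ge> 1"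
  shows "bernoulli_expectation p I (\<lambda>A. of_bool (real T \<le> (\<Sum>i\<in>A. t i)))
    \<le> exp (y * (\<Sum>i\<in>I. p i * t i)) / y ^ T"
proof -
  have "bernoulli_expectation p I (\<lambda>A. of_bool (real T \<le> (\<Sum>i\<in>A. t i)))
      \<le> bernoulli_expectation p I (\<lambda>A. (1 / y ^ T) * (\<Prod>i\<in>A. y powr t i))"
  proof (rule bernoulli_expectation_mono)
    fix A assume "A \<subseteq> I"
    hence fin: "finite A" using assms(1) finite_subset by blast
    have eq: "(\<Prod>i\<in>A. y powr t i) = y powr (\<Sum>i\<in>A. t i)"
      using assms(4) fin by (simp add: powr_sum)
    have "y ^ T \<le> y powr (\<Sum>i\<in>A. t i)" if "real T \<le> (\<Sum>i\<in>A. t i)"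
      using that assms(4) powr_mono[OF that, of y] by (simp add: powr_realpow)
    thus "of_bool (real T \<le> (\<Sum>i\<in>A. t i)) \<le> (1 / y ^ T) * (\<Prod>i\<in>A. y powr t i)"
      unfolding eq using assms(4) by (auto simp: field_simps)
  qed (use p in auto)
  also have "\<dots> = (\<Prod>i\<in>I. 1 + p i * (y powr t i - 1)) / y ^ T"
    by (simp only: bernoulli_expectation_cmult bernoulli_expectation_prod[OF assms(1)]) simp
  also have "(\<Prod>i\<in>I. 1 + p i * (y powr t i - 1)) \<le> (\<Prod>i\<in>I. exp (y * (p i * t i)))"
  proof (rule prod_mono)
    fix i assume i: "i \<in> I"
    have ge1: "1 \<le> y powr t i"
      using t[OF i] assms(4) by (simp add: ge_one_powr_ge_zero)
    have "y powr t i - 1 \<le> t i * y"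
      using powr_le_chord[of y "t i"] t[OF i] assms(4) by (simp add: algebra_simps)
    hence "p i * (y powr t i - 1) \<le> p i * (t i * y)"
      using p[OF i] by (intro mult_left_mono) auto
    also have "1 + p i * (t i * y) \<le> exp (y * (p i * t i))"
      using exp_ge_add_one_self[of "y * (p i * t i)"] by (simp add: mult_ac)
    finally show "0 \<le> 1 + p i * (y powr t i - 1) \<and>
        1 + p i * (y powr t i - 1) \<le> exp (y * (p i * t i))"
      using p[OF i] ge1 by auto
  qed
  also have "(\<Prod>i\<in>I. exp (y * (p i * t i))) = exp (y * (\<Sum>i\<in>I. p i * t i))"
    using assms(1) by (simp add: exp_sum sum_distrib_left)
  finally show ?thesis using assms(4) by (simp add: divide_right_mono)
qed

section \<open>Rounding sizes up to powers of two\<close>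

text \<open>The exponent is the least \<open>a\<close> with \<open>1 / 2 ^ Suc a < s\<close>.
  Minimality (or \<open>s \<le> 1\<close> if \<open>a = 0\<close>) gives
  \<open>s \<le> 1 / 2 ^ a\<close>, and the defining condition gives the factor 2. In particular the
  minimum in \<open>pow2_ceil\<close> is attained.\<close>

lemma pow2_ceil_properties:
  assumes "0 < s" "s \<le> 1"
  obtains a :: nat where "pow2_ceil s = 1 / 2 ^ a" "s \<le> 1 / 2 ^ a" "1 / 2 ^ a \<le> 2 * s"
proof -
  have "\<exists>a. 1 / 2 ^ Suc a < s"
  proof -
    obtain n where n: "(1/2) ^ n < s" using real_arch_pow_inv[of s "1/2"] assms by auto
    have "(1/2) ^ Suc n \<le> (1/2::real) ^ n" by simp
    with n show ?thesis by (intro exI[of _ n]) (simp add: power_one_over)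
  qed
  define a where "a = (LEAST a. 1 / 2 ^ Suc a < s)"
  have a: "1 / 2 ^ Suc a < s"
    unfolding a_def by (rule LeastI_ex) fact
  have "s \<le> 1 / 2 ^ a"
  proof (cases a)
    case (Suc b)
    hence "\<not> 1 / 2 ^ Suc b < s" using not_less_Least[of b "\<lambda>a. 1 / 2 ^ Suc a < s"]
      by (simp add: a_def)
    thus ?thesis using Suc by simp
  qed (use assms in auto)
  moreover have "pow2_ceil s = 1 / 2 ^ a"
    unfolding pow2_ceil_def
  proof (rule Least_equality)
    fix u :: real assume "(\<exists>b::nat. u = 1 / 2 ^ b) \<and> s \<le> u"
    then obtain b :: nat where b: "u = 1 / 2 ^ b" "s \<le> u" by auto
    have "b \<le> a"
    proof (rule ccontr)
      assume "\<not> b \<le> a"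
      hence "(2::real) ^ Suc a \<le> 2 ^ b" by (intro power_increasing) auto
      hence "u \<le> 1 / 2 ^ Suc a" unfolding b by (intro divide_left_mono) auto
      thus False using a b by linarith
    qed
    thus "1 / 2 ^ a \<le> u" unfolding b by (intro divide_left_mono power_increasing) auto
  qed (use calculation in auto)
  moreover have "1 / 2 ^ a \<le> 2 * s" using a by (simp add: field_simps)
  ultimately show thesis using that by blast
qed

lemma pow2_ceil_bounds:
  assumes "0 < s" "s \<le> 1"
  shows "0 < pow2_ceil s" "pow2_ceil s \<le> 1" "pow2_ceil s \<le> 2 * s"
proof -
  obtain a :: nat where "pow2_ceil s = 1 / 2 ^ a" "1 / 2 ^ a \<le> 2 * s"
    using pow2_ceil_properties[OF assms] by blast
  thus "0 < pow2_ceil s" "pow2_ceil s \<le> 1" "pow2_ceil s \<le> 2 * s" by auto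
qed

section \<open>Overflow events: monotonicity and probability\<close>

text \<open>The rounded sizes being summed are positive, so enlarging the sample cannot lower the
  load. This makes the non-overflow indicators decreasing, as the Harris inequality
  requires.\<close>

lemma overflow_mono:
  assumes "\<And>i. S $ j $ i \<le> 1" "A \<subseteq> A'" "overflow S c A i j"
  shows "overflow S c A' i j"
proof -
  have "(\<Sum>i' \<in> {i' \<in> A. S $ j $ i' > 0 \<and> pow2_ceil (S $ j $ i') \<ge> pow2_ceil (S $ j $ i)}.
        pow2_ceil (S $ j $ i'))
    \<le> (\<Sum>i' \<in> {i' \<in> A'. S $ j $ i' > 0 \<and> pow2_ceil (S $ j $ i') \<ge> pow2_ceil (S $ j $ i)}.
        pow2_ceil (S $ j $ i'))"
    using assms(1,2) pow2_ceil_bounds(1) by (intro sum_mono2) (auto intro: less_imp_le)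
  thus ?thesis using assms(3) unfolding overflow_def by linarith
qed

text \<open>In units of \<open>pow2_ceil (S $ j $ i)\<close>, the floor of the capacity and all
  counted sizes are integers, and \<open>i\<close> itself weighs one unit. A strict excess therefore
  leaves at least the floor once \<open>i\<close> is removed.\<close>

lemma overflow_insert_imp:
  fixes S :: "real^'n^'m"
  assumes le1: "\<And>i. S $ j $ i \<le> 1" and "S $ j $ i > 0" "i \<notin> A" "0 \<le> c $ j"
    and "overflow S c (insert i A) i j"
  shows "real (nat \<lfloor>c $ j\<rfloor>) \<le> (\<Sum>i' \<in> A. if S $ j $ i' > 0 then pow2_ceil (S $ j $ i') else 0)"
proof -
  let ?t = "\<lambda>i'. pow2_ceil (S $ j $ i')"
  obtain a :: nat where a: "?t i = 1 / 2 ^ a"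
    using pow2_ceil_properties assms(2) le1 by meson
  define G where "G = {i' \<in> A. S $ j $ i' > 0 \<and> ?t i' \<ge> ?t i}"
  have "?t i' * 2 ^ a \<in> \<int>" if i': "i' \<in> G" for i'
  proof -
    obtain b :: nat where b: "?t i' = 1 / 2 ^ b"
      using pow2_ceil_properties i' le1 unfolding G_def by blast
    have "?t i \<le> ?t i'" using i' by (simp add: G_def)
    hence "1 / 2 ^ a \<le> (1 / 2 ^ b :: real)" unfolding a b .
    hence "(2::real) ^ b \<le> 2 ^ a" by (simp add: field_simps)
    hence "b \<le> a" by simp
    hence "?t i' * 2 ^ a = 2 ^ (a - b)" unfolding b by (simp add: power_diff)
    thus ?thesis by simp
  qed
  hence "(\<Sum>i'\<in>G. ?t i' * 2 ^ a) \<in> \<int>" by (rule Ints_sum)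
  then obtain n :: int where n: "(\<Sum>i'\<in>G. ?t i') * 2 ^ a = of_int n"
    unfolding sum_distrib_right[symmetric] by (auto elim: Ints_cases)
  have split: "{i' \<in> insert i A. S $ j $ i' > 0 \<and> ?t i' \<ge> ?t i} = insert i G"
    using assms(2) by (auto simp: G_def)
  have "i \<notin> G" using assms(3) by (simp add: G_def)
  hence "c $ j < ?t i + (\<Sum>i'\<in>G. ?t i')"
    using assms(5) unfolding overflow_def split by simp
  hence "of_int \<lfloor>c $ j\<rfloor> < ?t i + (\<Sum>i'\<in>G. ?t i')" by linarith
  hence "of_int \<lfloor>c $ j\<rfloor> * 2 ^ a < (?t i + (\<Sum>i'\<in>G. ?t i')) * 2 ^ a"
    by (intro mult_strict_right_mono) auto
  also have "\<dots> = of_int (1 + n)" by (simp add: distrib_right n a)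
  finally have "of_int (\<lfloor>c $ j\<rfloor> * 2 ^ a) < (of_int (1 + n) :: real)" by simp
  \<comment> \<open>Strictness together with integrality absorbs the single unit contributed by
    \<open>i\<close>.\<close>
  hence "\<lfloor>c $ j\<rfloor> * 2 ^ a \<le> n" unfolding of_int_less_iff by linarith
  hence "of_int (\<lfloor>c $ j\<rfloor> * 2 ^ a) \<le> (of_int n :: real)" by (simp only: of_int_le_iff)
  hence "of_int \<lfloor>c $ j\<rfloor> * 2 ^ a \<le> (\<Sum>i'\<in>G. ?t i') * 2 ^ a" unfolding n by simp
  hence "of_int \<lfloor>c $ j\<rfloor> \<le> (\<Sum>i'\<in>G. ?t i')" by simp
  also have "\<dots> = (\<Sum>i'\<in>G. if S $ j $ i' > 0 then ?t i' else 0)"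
    by (intro sum.cong) (auto simp: G_def)
  \<comment> \<open>The size threshold is dropped, so that the load can be compared with the LP
    constraint for \<open>j\<close>.\<close>
  also have "\<dots> \<le> (\<Sum>i'\<in>A. if S $ j $ i' > 0 then ?t i' else 0)"
    using le1 pow2_ceil_bounds(1) by (intro sum_mono2) (auto simp: G_def intro: less_imp_le)
  finally show ?thesis using assms(4) by simp
qed

text \<open>The constant 4 pays a factor 2 for rounding sizes up and a factor 2 for rounding the
  capacity down. Hence \<open>exp 1 * q\<close> times the mean load is at most \<open>T\<close>, and
  the Chernoff bound with this base collapses to \<open>1 / q ^ T\<close>.\<close>

lemma overflow_expectation_le:
  fixes S :: "real^'n^'m" and p :: "'n \<Rightarrow> real" and b k :: nat
  assumes "\<And>i. 0 \<le> S $ j $ i \<and> S $ j $ i \<le> 1" and "S $ j $ i > 0"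
    and p: "\<And>i. 0 \<le> p i \<and> p i \<le> 1"
    and "1 \<le> b" "1 \<le> k" "real b \<le> c $ j"
    and load: "(\<Sum>i\<in>UNIV. S $ j $ i * p i) \<le> c $ j / (4 * exp 1 * (real b * real k) powr (1 / real b))"
  shows "bernoulli_expectation p (- {i}) (\<lambda>A. of_bool (overflow S c (insert i A) i j))
    \<le> 1 / (real k * real b)"
proof -
  define t where "t = (\<lambda>i'. if S $ j $ i' > 0 then pow2_ceil (S $ j $ i') else 0)"
  define q where "q = (real b * real k) powr (1 / real b)"
  define T where "T = nat \<lfloor>c $ j\<rfloor>"
  define \<mu> where "\<mu> = (\<Sum>i'\<in>-{i}. p i' * t i')"
  have bk: "1 \<le> real b * real k"
    using assms(4,5) by (metis mult_le_mono of_nat_1 of_nat_le_iff of_nat_mult mult_1)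
  have q1: "1 \<le> q" unfolding q_def using bk by (intro ge_one_powr_ge_zero) auto
  have t: "0 \<le> t i' \<and> t i' \<le> 1 \<and> t i' \<le> 2 * S $ j $ i'" for i'
    using pow2_ceil_bounds[of "S $ j $ i'"] assms(1)[of i'] unfolding t_def by auto
  \<comment> \<open>From \<open>1 \<le> b \<le> T\<close> it follows that
    \<open>c $ j < T + 1 \<le> 2 * T\<close>.\<close>
  have cT: "c $ j \<le> 2 * real T" "b \<le> T" "0 \<le> c $ j"
  proof -
    show "0 \<le> c $ j" using assms(6) by linarith
    have "int b \<le> \<lfloor>c $ j\<rfloor>" using assms(6) by (simp add: le_floor_iff)
    thus "b \<le> T" unfolding T_def by linarith
    hence "1 \<le> real T" using assms(4) by linarith
    moreover have "c $ j < real T + 1" unfolding T_def using \<open>0 \<le> c $ j\<close> by linarith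
    ultimately show "c $ j \<le> 2 * real T" by linarith
  qed
  have "\<mu> \<le> (\<Sum>i'\<in>-{i}. 2 * (S $ j $ i' * p i'))"
    unfolding \<mu>_def
  proof (rule sum_mono)
    fix i'
    have "t i' * p i' \<le> (2 * S $ j $ i') * p i'" using t p by (intro mult_right_mono) auto
    thus "p i' * t i' \<le> 2 * (S $ j $ i' * p i')" by (simp add: mult_ac)
  qed
  also have "\<dots> \<le> (\<Sum>i'\<in>UNIV. 2 * (S $ j $ i' * p i'))"
    using assms(1) p by (intro sum_mono2) auto
  also have "\<dots> \<le> 2 * (c $ j / (4 * exp 1 * q))"
    unfolding sum_distrib_left[symmetric] q_def by (intro mult_left_mono load) simp
  also have "\<dots> \<le> 2 * (2 * real T / (4 * exp 1 * q))"
    using cT q1 by (intro mult_left_mono divide_right_mono) auto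
  finally have "(exp 1 * q) * \<mu> \<le> (exp 1 * q) * (2 * (2 * real T / (4 * exp 1 * q)))"
    using q1 by (intro mult_left_mono) auto
  also have "\<dots> = real T" using q1 by simp
  finally have mu: "exp 1 * q * \<mu> \<le> real T" .
  have y1: "1 \<le> exp 1 * q"
    using q1 mult_mono[of 1 "exp 1" 1 q] by simp
  have "bernoulli_expectation p (- {i}) (\<lambda>A. of_bool (overflow S c (insert i A) i j))
      \<le> bernoulli_expectation p (- {i}) (\<lambda>A. of_bool (real T \<le> (\<Sum>i\<in>A. t i)))"
    using p assms(1,2) cT(3) overflow_insert_imp[of S j i _ c]
    by (intro bernoulli_expectation_mono) (auto simp: T_def t_def)
  also have "\<dots> \<le> exp (exp 1 * q * \<mu>) / (exp 1 * q) ^ T"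
    unfolding \<mu>_def using p t y1 by (intro chernoff_bound) auto
  also have "\<dots> \<le> exp (real T) / (exp 1 * q) ^ T"
    using mu q1 by (intro divide_right_mono) auto
  also have "\<dots> = 1 / q ^ T"
    by (simp add: power_mult_distrib exp_of_nat_mult[of T 1, simplified])
  \<comment> \<open>Since \<open>q \<ge> 1\<close>, the exponent may be lowered from
    \<open>T\<close> to \<open>b\<close>; \<open>q\<close> is the \<open>b\<close>-th root of
    \<open>b * k\<close>.\<close>
  also have "\<dots> \<le> 1 / q ^ b"
    using q1 cT(2) by (intro divide_left_mono power_increasing) auto
  also have "q ^ b = real b * real k"
  proof -
    have "q ^ b = q powr real b" using q1 by (simp add: powr_realpow)
    thus ?thesis unfolding q_def using bk assms(4) by (simp add: powr_powr)
  qed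
  finally show ?thesis by (simp add: mult.commute)
qed

section \<open>From the probability space to finite sums\<close>

context prob_space
begin

text \<open>Independence speaks of intersections of inclusion events. Avoiding one more
  \<open>j\<close> is a difference of two such events, one of which has \<open>j\<close> added to
  \<open>I\<close>; hence \<open>I\<close> varies in the induction on \<open>J\<close>.\<close>

lemma prob_include_exclude:
  fixes R :: "'a \<Rightarrow> 'n set"
  assumes ind: "indep_events (\<lambda>i. {\<omega> \<in> space M. i \<in> R \<omega>}) UNIV"
    and "finite J" "finite I" "I \<inter> J = {}"
  shows "prob {\<omega> \<in> space M. I \<subseteq> R \<omega> \<and> R \<omega> \<inter> J = {}} =
    (\<Prod>i\<in>I. prob {\<omega> \<in> space M. i \<in> R \<omega>}) * (\<Prod>j\<in>J. 1 - prob {\<omega> \<in> space M. j \<in> R \<omega>})"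
  using assms(2-4)
proof (induction J arbitrary: I)
  case empty
  show ?case
  \<comment> \<open>\<open>indep_events\<close> covers nonempty index sets, and an empty
    intersection would be \<open>UNIV\<close> rather than \<open>space M\<close>.\<close>
  proof (cases "I = {}")
    case False
    have "{\<omega> \<in> space M. I \<subseteq> R \<omega> \<and> R \<omega> \<inter> {} = {}} = (\<Inter>i\<in>I. {\<omega> \<in> space M. i \<in> R \<omega>})"
      using False by auto
    thus ?thesis using ind False empty unfolding indep_events_def by simp
  qed (simp add: prob_space)
next
  case (insert j J)
  have ev: "{\<omega> \<in> space M. i \<in> R \<omega>} \<in> events" for i
    using ind unfolding indep_events_def by auto
  have meas: "{\<omega> \<in> space M. K \<subseteq> R \<omega> \<and> R \<omega> \<inter> J = {}} \<in> events" if "finite K" for K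
  proof -
    have "{\<omega> \<in> space M. K \<subseteq> R \<omega> \<and> R \<omega> \<inter> J = {}} =
      {\<omega> \<in> space M. (\<forall>i\<in>K. i \<in> R \<omega>) \<and> (\<forall>i\<in>J. i \<notin> R \<omega>)}" by auto
    also have "\<dots> \<in> events"
      using ev that insert.hyps
      by (intro sets.sets_Collect_conj sets.sets_Collect_finite_All sets.sets_Collect_neg) auto
    finally show ?thesis .
  qed
  let ?F = "\<lambda>K. {\<omega> \<in> space M. K \<subseteq> R \<omega> \<and> R \<omega> \<inter> J = {}}"
  have "{\<omega> \<in> space M. I \<subseteq> R \<omega> \<and> R \<omega> \<inter> insert j J = {}} = ?F I - ?F (insert j I)" by auto
  moreover have "prob (?F I - ?F (insert j I)) = prob (?F I) - prob (?F (insert j I))"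
  proof (rule finite_measure_Diff)
    show "?F I \<in> events" "?F (insert j I) \<in> events" by (intro meas; simp add: insert.prems)+
  qed auto
  ultimately have "prob {\<omega> \<in> space M. I \<subseteq> R \<omega> \<and> R \<omega> \<inter> insert j J = {}} =
      prob (?F I) - prob (?F (insert j I))" by simp
  thus ?case using insert by (simp add: insert.IH algebra_simps del: insert_subset)
qed

text \<open>The event splits into finitely many disjoint pieces according to the sampled items other
  than \<open>i\<close>. Each piece carries a factor \<open>p i\<close>, which cancels against the
  probability of the condition.\<close>

lemma cond_prob_eq_bernoulli_expectation:
  fixes R :: "'a \<Rightarrow> ('n::finite) set"
  assumes ind: "indep_events (\<lambda>i. {\<omega> \<in> space M. i \<in> R \<omega>}) UNIV"
    and p: "\<And>i. prob {\<omega> \<in> space M. i \<in> R \<omega>} = p i"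
    and "p i \<noteq> 0"
  shows "cond_prob M (\<lambda>\<omega>. Q (R \<omega>)) (\<lambda>\<omega>. i \<in> R \<omega>) =
    bernoulli_expectation p (- {i}) (\<lambda>A. of_bool (Q (insert i A)))"
proof -
  \<comment> \<open>For \<open>A \<subseteq> - {i}\<close> this is the event that
    \<open>R \<omega> = insert i A\<close>, put in the form to which
    \<open>prob_include_exclude\<close> applies.\<close>
  define F where "F = (\<lambda>A. {\<omega> \<in> space M. insert i A \<subseteq> R \<omega> \<and> R \<omega> \<inter> (- {i} - A) = {}})"
  have ev: "{\<omega> \<in> space M. i \<in> R \<omega>} \<in> events" for i
    using ind unfolding indep_events_def by auto
  have meas: "F A \<in> events" for A
  proof -
    have "F A = {\<omega> \<in> space M. (\<forall>i\<in>insert i A. i \<in> R \<omega>) \<and> (\<forall>i\<in>- {i} - A. i \<notin> R \<omega>)}"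
      by (auto simp: F_def)
    also have "\<dots> \<in> events"
      using ev
      by (intro sets.sets_Collect_conj sets.sets_Collect_finite_All sets.sets_Collect_neg) auto
    finally show ?thesis .
  qed
  have F: "F A = {\<omega> \<in> space M. R \<omega> = insert i A}" if "A \<subseteq> - {i}" for A
    using that by (auto simp: F_def)
  let ?C = "{A \<in> Pow (- {i}). Q (insert i A)}"
  have "{\<omega> \<in> space M. Q (R \<omega>) \<and> i \<in> R \<omega>} = (\<Union>A\<in>?C. F A)"
  proof (intro equalityI subsetI)
    fix \<omega> assume w: "\<omega> \<in> {\<omega> \<in> space M. Q (R \<omega>) \<and> i \<in> R \<omega>}"
    hence "insert i (R \<omega> - {i}) = R \<omega>" by auto
    with w have "R \<omega> - {i} \<in> ?C" "\<omega> \<in> F (R \<omega> - {i})" by (auto simp: F)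
    thus "\<omega> \<in> (\<Union>A\<in>?C. F A)" by blast
  qed (auto simp: F)
  moreover have "disjoint_family_on F ?C"
    by (auto simp: disjoint_family_on_def F)
  ultimately have "prob {\<omega> \<in> space M. Q (R \<omega>) \<and> i \<in> R \<omega>} = (\<Sum>A\<in>?C. prob (F A))"
    using meas by (simp add: finite_measure_finite_Union image_subset_iff)
  also have "\<dots> = (\<Sum>A\<in>?C. p i * ((\<Prod>i\<in>A. p i) * (\<Prod>i\<in>- {i} - A. 1 - p i)))"
  proof (rule sum.cong)
    fix A assume "A \<in> ?C"
    hence "i \<notin> A" by auto
    have "prob (F A) = (\<Prod>i\<in>insert i A. p i) * (\<Prod>i\<in>- {i} - A. 1 - p i)"
      unfolding F_def using prob_include_exclude[OF ind, of "- {i} - A" "insert i A"]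
      by (simp add: p del: insert_subset)
    thus "prob (F A) = p i * ((\<Prod>i\<in>A. p i) * (\<Prod>i\<in>- {i} - A. 1 - p i))"
      using \<open>i \<notin> A\<close> by simp
  qed simp
  also have "\<dots> = p i * bernoulli_expectation p (- {i}) (\<lambda>A. of_bool (Q (insert i A)))"
    unfolding bernoulli_expectation_def sum_distrib_left[symmetric]
    by (intro arg_cong[where f = "\<lambda>u. p i * u"] sum.mono_neutral_cong_left) auto
  finally show ?thesis
    using assms(3) by (simp add: cond_prob_def p)
qed

end

section \<open>Consequences of the rescaling\<close>

lemma rescaled_le_1: "rescaled S \<Longrightarrow> S $ j $ i \<le> 1"
proof (cases "S $ j $ i > 0")
  case True
  assume "rescaled S"
  hence "Max {S $ j $ i | i. S $ j $ i > 0} = 1" unfolding rescaled_def by blast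
  thus ?thesis using True Max_ge[of "{S $ j $ i | i. S $ j $ i > 0}" "S $ j $ i"] by auto
qed simp

lemma rescaled_attains_1:
  assumes "rescaled S"
  obtains i where "S $ j $ i = 1"
proof -
  have "{S $ j $ i | i. S $ j $ i > 0} \<noteq> {}" "Max {S $ j $ i | i. S $ j $ i > 0} = 1"
    using assms unfolding rescaled_def by blast+
  hence "1 \<in> {S $ j $ i | i. S $ j $ i > 0}"
    using Max_in[of "{S $ j $ i | i. S $ j $ i > 0}"] by simp
  thus thesis using that by auto
qed

text \<open>Dividing a capacity by an entry in (0, 1] cannot decrease it, and an entry equal to 1 in
  the row of smallest capacity attains the minimum.\<close>

lemma rescaled_slack_eq:
  fixes S :: "real^'n^'m"
  assumes "rescaled S" "\<And>j. 0 \<le> c $ j"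
  shows "slack S c = Min (range (\<lambda>j. c $ j))"
  unfolding slack_def
proof (rule Min_eqI)
  have "{c $ j / S $ j $ i | i j. S $ j $ i > 0} \<subseteq> range (\<lambda>(i, j). c $ j / S $ j $ i)" by auto
  thus "finite {c $ j / S $ j $ i | i j. S $ j $ i > 0}" by (rule finite_subset) simp
next
  fix v assume "v \<in> {c $ j / S $ j $ i | i j. S $ j $ i > 0}"
  then obtain i j where v: "v = c $ j / S $ j $ i" "S $ j $ i > 0" by auto
  have "Min (range (\<lambda>j. c $ j)) \<le> c $ j / 1" by simp
  also have "\<dots> \<le> v" unfolding v
    using v rescaled_le_1[OF assms(1)] assms(2) by (intro divide_left_mono) auto
  finally show "Min (range (\<lambda>j. c $ j)) \<le> v" .
next
  have "Min (range (\<lambda>j. c $ j)) \<in> range (\<lambda>j. c $ j)" by (intro Min_in) auto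
  then obtain j where j: "Min (range (\<lambda>j. c $ j)) = c $ j" by blast
  obtain i where "S $ j $ i = 1" using rescaled_attains_1[OF assms(1)] .
  thus "Min (range (\<lambda>j. c $ j)) \<in> {c $ j / S $ j $ i | i j. S $ j $ i > 0}"
    unfolding j by (auto intro!: exI[of _ i] exI[of _ j])
qed

section \<open>Survival probability of a sampled item\<close>

theorem theorem8:
  fixes k :: nat
    and w x :: "real^'n"
    and S :: "real^'n^'m"
    and c :: "real^'m"
    and B \<alpha> :: real
    and M :: "'a measure"
    and R :: "'a \<Rightarrow> 'n set"
  assumes "k_cs_pip k w S c"
    and "\<forall>i j. S $ j $ i \<le> c $ j"
    and "rescaled S"
    and "B = Min (range (\<lambda>j. c $ j))"
    and "\<alpha> = 4 * exp 1 * (real_of_int \<lfloor>B\<rfloor> * real k) powr (1 / real_of_int \<lfloor>B\<rfloor>)"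
    and "lp_optimal w S c x"
    and "prob_space M"
    and "prob_space.indep_events M (\<lambda>i. {\<omega> \<in> space M. i \<in> R \<omega>}) UNIV"
    and "\<forall>i. measure M {\<omega> \<in> space M. i \<in> R \<omega>} = x $ i / \<alpha>"
  shows "B \<ge> 1 \<and> B = slack S c \<and>
    (\<forall>i. x $ i > 0 \<longrightarrow>
      cond_prob M (\<lambda>\<omega>. i \<in> altered S c (R \<omega>)) (\<lambda>\<omega>. i \<in> R \<omega>)
        \<ge> (1 - 1 / (real k * real_of_int \<lfloor>B\<rfloor>)) ^ k)"
proof -
  interpret prob_space M by fact
  have S: "0 \<le> S $ j $ i \<and> S $ j $ i \<le> 1" for i j
    using assms(1) rescaled_le_1[OF assms(3)] unfolding k_cs_pip_def by auto
  have c1: "1 \<le> c $ j" for j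
    using rescaled_attains_1[OF assms(3), of j] assms(2) by metis
  have B1: "B \<ge> 1" unfolding assms(4) using c1 by (subst Min_ge_iff) auto
  have Bc: "B \<le> c $ j" for j unfolding assms(4) by simp
  have slack: "B = slack S c"
    unfolding assms(4) using c1 order_trans[OF zero_le_one]
    by (intro rescaled_slack_eq[OF assms(3), symmetric]) blast
  \<comment> \<open>The row of an arbitrary constraint, here \<open>undefined\<close>, contains an
    entry 1, so some column has a nonzero entry.\<close>
  have k1: "1 \<le> k"
  proof -
    obtain i where "S $ undefined $ i = 1" using rescaled_attains_1[OF assms(3)] .
    hence "undefined \<in> {j. S $ j $ i \<noteq> 0}" by simp
    hence "{j. S $ j $ i \<noteq> 0} \<noteq> {}" by blast
    hence "card {j. S $ j $ i \<noteq> 0} \<noteq> 0" by simp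
    moreover have "card {j. S $ j $ i \<noteq> 0} \<le> k" using assms(1) unfolding k_cs_pip_def by blast
    ultimately show ?thesis by linarith
  qed
  define b where "b = nat \<lfloor>B\<rfloor>"
  have b: "real_of_int \<lfloor>B\<rfloor> = real b" "1 \<le> b" "real b \<le> B"
    using B1 unfolding b_def by linarith+
  have \<alpha>: "\<alpha> = 4 * exp 1 * (real b * real k) powr (1 / real b)" "0 < \<alpha>"
    using assms(5) b k1 by auto
  define p where "p = (\<lambda>i. x $ i / \<alpha>)"
  have p: "prob {\<omega> \<in> space M. i \<in> R \<omega>} = p i" for i using assms(9) by (simp add: p_def)
  \<comment> \<open>Each \<open>p i\<close> is the probability of an event.\<close>
  have p01: "0 \<le> p i \<and> p i \<le> 1" for i
    using p[of i] prob_le_1[of "{\<omega> \<in> space M. i \<in> R \<omega>}"]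
      measure_nonneg[of M "{\<omega> \<in> space M. i \<in> R \<omega>}"] by simp
  have feas: "(\<Sum>i\<in>UNIV. S $ j $ i * x $ i) \<le> c $ j" for j
    using assms(6) unfolding lp_optimal_def is_arg_max_def lp_feasible_def
    by (simp add: less_eq_vec_def matrix_vector_mult_def)
  have load: "(\<Sum>i\<in>UNIV. S $ j $ i * p i) \<le> c $ j / \<alpha>" for j
    using divide_right_mono[OF feas, of \<alpha> j] \<alpha>(2) by (simp add: p_def sum_divide_distrib)
  define r where "r = 1 - 1 / (real k * real b)"
  have r: "0 \<le> r" "r \<le> 1"
  proof -
    have "1 \<le> k * b" using k1 b(2) by (metis mult_le_mono mult_1)
    hence "1 \<le> real k * real b" by (metis of_nat_1 of_nat_le_iff of_nat_mult)
    thus "0 \<le> r" "r \<le> 1" unfolding r_def by auto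
  qed
  have main: "r ^ k \<le> cond_prob M (\<lambda>\<omega>. i \<in> altered S c (R \<omega>)) (\<lambda>\<omega>. i \<in> R \<omega>)"
    if i: "x $ i > 0" for i
  proof -
    let ?E = "bernoulli_expectation p (- {i})"
    define J where "J = {j. S $ j $ i > 0}"
    define f where "f = (\<lambda>j A. of_bool (\<not> overflow S c (insert i A) i j) :: real)"
    have "J = {j. S $ j $ i \<noteq> 0}" using S by (auto simp: J_def less_le)
    hence "card J \<le> k" using assms(1) unfolding k_cs_pip_def by blast
    \<comment> \<open>Item \<open>i\<close> may occur in fewer than \<open>k\<close> constraints;
      since \<open>r\<close> lies in [0, 1], the missing factors only lower the bound.\<close>
    hence "r ^ k \<le> r ^ card J" using r by (intro power_decreasing) auto
    also have "\<dots> = (\<Prod>j\<in>J. r)" by simp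
    also have "\<dots> \<le> (\<Prod>j\<in>J. ?E (f j))"
    proof (intro prod_mono conjI r(1))
      fix j assume j: "j \<in> J"
      have "?E (\<lambda>A. of_bool (overflow S c (insert i A) i j)) \<le> 1 / (real k * real b)"
        using S j p01 b k1 Bc[of j] load[of j] \<alpha>(1)
        by (intro overflow_expectation_le) (auto simp: J_def)
      moreover have "?E (f j) = ?E (\<lambda>A. 1 - of_bool (overflow S c (insert i A) i j))"
        by (intro bernoulli_expectation_cong) (simp add: f_def)
      ultimately show "r \<le> ?E (f j)"
        by (simp add: bernoulli_expectation_diff bernoulli_expectation_const r_def)
    qed
    also have "\<dots> \<le> ?E (\<lambda>A. \<Prod>j\<in>J. f j A)"
    proof (rule harris_inequality_prod)
      fix j
      have mono: "overflow S c (insert i A') i j"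
        if "A \<subseteq> A'" "overflow S c (insert i A) i j" for A A'
      proof (rule overflow_mono)
        show "S $ j $ i' \<le> 1" for i' using S by blast
        show "insert i A \<subseteq> insert i A'" using that(1) by blast
      qed (fact that(2))
      show "antimono_on (Pow (- {i})) (f j)"
      proof (rule monotone_onI)
        fix A A' :: "'n set" assume "A \<subseteq> A'"
        thus "f j A' \<le> f j A" using mono[of A A'] by (auto simp: f_def)
      qed
    qed (use p01 in \<open>auto simp: f_def\<close>)
    \<comment> \<open>A product of 0/1 indicators is the indicator that no overflow event for
      \<open>i\<close> occurs.\<close>
    also have "\<dots> = ?E (\<lambda>A. of_bool (i \<in> altered S c (insert i A)))"
      by (intro bernoulli_expectation_cong) (auto simp: altered_def J_def f_def)
    also have "\<dots> = cond_prob M (\<lambda>\<omega>. i \<in> altered S c (R \<omega>)) (\<lambda>\<omega>. i \<in> R \<omega>)"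
      using i \<alpha>(2)
      by (intro cond_prob_eq_bernoulli_expectation[symmetric, where Q = "\<lambda>A. i \<in> altered S c A"]
          assms(8) p) (simp add: p_def)
    finally show ?thesis .
  qed
  show ?thesis using B1 slack main unfolding r_def b(1) by blast
qed

end
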